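(* Let $U$ be a random vector taking values in $[-\infty,\infty)^d$ such that (U) $0<\mathbb E[e^{U_j}]<\infty$ for all $j=1,\dots,d$. Let $S$ be defined in distribution by $$\Pr[S\in\,\cdot\,]=\frac{\mathbb E\bigl[\mathbf 1\{U-\max(U)\in\,\cdot\,\}\,e^{\max(U)}\bigr]}{\mathbb E[e^{\max(U)}]}.$$ Then $S$ is a spectral random vector, and the associated generalized Pareto distribution $\operatorname{GP}(\mathbf 1,\mathbf 0,\pi,\ell)=\operatorname{GP}_S(\mathbf 1,\mathbf 0,\mathcal L(S))$, i.e. the law of $S+E$ with $E$ unit exponential independent of $S$, is determined by $$\pi_j=\frac{\mathbb E[e^{U_j}]}{\mathbb E[e^{\max(U)}]},\quad j=1,\dots,d,$$ $$\ell(y)=\mathbb E\left[\max_{j=1,\dots,d}\left\{y_j\,\frac{e^{U_j}}{\mathbb E[e^{U_j}]}\right\}\right],\quad y\in[0,\infty)^d.$$ The associated cdf is given by $$H(z)=1-\frac{\mathbb E\bigl[e^{\max(U)}\wedge e^{\max(U-z)}\bigr]}{\mathbb E[e^{\max(U)}]},\qquad z\in\mathbb R^d.$$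
   Context: Conventions: operations and order relations between vectors are componentwise, scalars being applied to every component; $a\wedge b=\min(a,b)$; $\max(x)=\max(x_1,\dots,x_d)$; $e^{-\infty}=0$; $\mathcal L(\xi)$ is the law of $\xi$; $\mathbf 1\{\cdot\}$ is an indicator; as parameter vectors, $\mathbf 1=(1,\dots,1)$, $\mathbf 0=(0,\dots,0)$. On the event $\{\max(U)=-\infty\}$ the integrand $\mathbf 1\{U-\max(U)\in\cdot\}e^{\max(U)}$ is $0$. A random vector $S$ with values in $[-\infty,0]^d$ is called a spectral random vector if $\Pr[\max(S_1,\dots,S_d)=0]=1$ and $\Pr[S_j>-\infty]>0$ for all $j=1,\dots,d$. A function $\ell:[0,\infty)^d\to[0,\infty)$ is a stable tail dependence function (stdf) if there is a random vector $V$ with values in $[0,\infty)^d$ and $\mathbb E[V_j]=1$ for all $j$ such that $\ell(y)=\mathbb E[\max_{j}(y_jV_j)]$ for all $y\in[0,\infty)^d$. For $\pi\in(0,1]^d$ and a stdf $\ell$ with $\ell(\pi)=1$, $\operatorname{GP}(\mathbf 1,\mathbf 0,\pi,\ell)$ is the probability distribution concentrated on $[-\infty,\infty)^d\setminus[-\infty,0]^d$ with cdf $H(z)=\ell(\pi e^{-(z\wedge 0)})-\ell(\pi e^{-z})$, $z\in\mathbb R^d$. For a spectral random vector $S$, $\operatorname{GP}_S(\mathbf 1,\mathbf 0,\mathcal L(S))$ denotes the law of $S+E$, where $E$ is a unit exponential random variable independent of $S$; it is of the form $\operatorname{GP}(\mathbf 1,\mathbf 0,\pi,\ell)$ for a unique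 pair $(\pi,\ell)$. *)

theory Defs
  imports "HOL-Probability.Probability"
begin

definition vmax :: "('a::linorder) ^ 'd::finite \<Rightarrow> 'a" where
  "vmax x = Max (range (\<lambda>j. x $ j))"

text \<open>The exponential on $[-\infty,\infty)$, with $e^{-\infty}=0$. The value at
  \<open>\<infinity>\<close> is an artefact of totality and is only ever relevant outside the intended range.\<close>

definition eexp :: "ereal \<Rightarrow> real" where
  "eexp x = (if x = -\<infinity> then 0 else exp (real_of_ereal x))"

text \<open>The support condition holds almost surely, because spectral random vectors are
  typically specified in distribution only.\<close>

definition spectral_random_vector :: "'a measure \<Rightarrow> ('a \<Rightarrow> ereal ^ 'd::finite) \<Rightarrow> bool" where
  "spectral_random_vector N S \<longleftrightarrow>
     prob_space N \<and> S \<in> borel_measurable N \<and>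
     (AE x in N. \<forall>j. S x $ j \<le> 0) \<and>
     measure N {x \<in> space N. vmax (S x) = 0} = 1 \<and>
     (\<forall>j. measure N {x \<in> space N. S x $ j > -\<infinity>} > 0)"

text \<open>The generating random vector \<open>V\<close> enters through its law \<open>\<nu>\<close>, as HOL cannot
  quantify over the type of the underlying sample space. Each coordinate is integrable because
  its Bochner integral is nonzero, hence so is the maximum. Only the values of \<open>l\<close> on the
  nonnegative orthant matter.\<close>

definition is_stdf :: "(real ^ 'd::finite \<Rightarrow> real) \<Rightarrow> bool" where
  "is_stdf l \<longleftrightarrow>
     (\<exists>\<nu> :: (real ^ 'd) measure.
        prob_space \<nu> \<and> sets \<nu> = sets borel \<and>
        (AE v in \<nu>. \<forall>j. 0 \<le> v $ j) \<and>
        (\<forall>j. (\<integral>v. v $ j \<partial>\<nu>) = 1) \<and>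
        (\<forall>y. (\<forall>j. 0 \<le> y $ j) \<longrightarrow> l y = (\<integral>v. vmax (\<chi> j. y $ j * v $ j) \<partial>\<nu>)))"

text \<open>\<open>is_GP G p l\<close> says that \<open>(p, l)\<close> are admissible parameters and that \<open>G\<close> is the
  distribution $\mathrm{GP}(\mathbf 1,\mathbf 0,p,l)$. Since \<open>G\<close> charges no vector with an infinite
  positive coordinate, the values of its cdf at real vectors determine it.\<close>

definition is_GP :: "(ereal ^ 'd::finite) measure \<Rightarrow> real ^ 'd \<Rightarrow> (real ^ 'd \<Rightarrow> real) \<Rightarrow> bool" where
  "is_GP G p l \<longleftrightarrow>
     (\<forall>j. 0 < p $ j \<and> p $ j \<le> 1) \<and> is_stdf l \<and> l p = 1 \<and>
     prob_space G \<and> sets G = sets borel \<and>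
     (AE x in G. (\<forall>j. x $ j < \<infinity>) \<and> \<not> (\<forall>j. x $ j \<le> 0)) \<and>
     (\<forall>z :: real ^ 'd. measure G {x. \<forall>j. x $ j \<le> ereal (z $ j)} =
        l (\<chi> j. p $ j * exp (- min (z $ j) 0)) - l (\<chi> j. p $ j * exp (- (z $ j))))"

text \<open>The law of \<open>S + E\<close> as a function of the law \<open>Q\<close> of \<open>S\<close>: the product measure is the
  joint law of \<open>S\<close> and an independent unit exponential \<open>E\<close>; see \<open>distr_add_exponential\<close>
  below.\<close>

definition GP_S :: "(ereal ^ 'd::finite) measure \<Rightarrow> (ereal ^ 'd) measure" where
  "GP_S Q = distr (Q \<Otimes>\<^sub>M density lborel (exponential_density 1)) borel
              (\<lambda>(s, e). \<chi> j. s $ j + ereal e)"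

text \<open>When $\max(U) = -\infty$ the integrand vanishes whatever value
  \<open>-\<infinity> - (-\<infinity>)\<close> takes, because the second factor does.\<close>

definition spectral_prob :: "'a measure \<Rightarrow> ('a \<Rightarrow> ereal ^ 'd::finite) \<Rightarrow> (ereal ^ 'd) set \<Rightarrow> real" where
  "spectral_prob M U A =
     (\<integral>x. indicator A (\<chi> j. U x $ j - vmax (U x)) * eexp (vmax (U x)) \<partial>M)
     / (\<integral>x. eexp (vmax (U x)) \<partial>M)"

lemma borel_measurable_vec_lambda_ereal:
  fixes f :: "'d::finite \<Rightarrow> 'a \<Rightarrow> ereal"
  assumes "\<And>j. f j \<in> borel_measurable M"
  shows "(\<lambda>x. \<chi> j. f j x) \<in> borel_measurable M"
proof (rule borel_measurableI)
  fix W :: "(ereal ^ 'd) set" assume W: "open W"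
  obtain B :: "ereal set set" where B: "countable B" "topological_basis B"
    using ex_countable_basis by auto
  define C where "C = {b \<in> PiE UNIV (\<lambda>_::'d. B). \<forall>x. (\<forall>j. x $ j \<in> b j) \<longrightarrow> x \<in> W}"
  have cC: "countable C"
    by (rule countable_subset[of _ "PiE UNIV (\<lambda>_::'d. B)"])
      (auto simp: C_def intro: countable_PiE B)
  have "\<exists>b\<in>C. \<forall>j. x $ j \<in> b j" if x: "x \<in> W" for x
  proof -
    from W x have "\<exists>A. (\<forall>j. open (A j) \<and> x $ j \<in> A j) \<and> (\<forall>y. (\<forall>j. y $ j \<in> A j) \<longrightarrow> y \<in> W)"
      unfolding open_vec_def by (rule bspec)
    then obtain A where A: "\<forall>j. open (A j) \<and> x $ j \<in> A j"
      "\<forall>y. (\<forall>j. y $ j \<in> A j) \<longrightarrow> y \<in> W"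
      by (elim exE conjE)
    have "\<exists>b. b \<in> B \<and> x $ j \<in> b \<and> b \<subseteq> A j" for j
    proof -
      have o: "open (A j)" "x $ j \<in> A j" using A(1) by simp_all
      show ?thesis by (rule topological_basisE[OF B(2) o]) (intro exI conjI)
    qed
    then have "\<forall>j. \<exists>b. b \<in> B \<and> x $ j \<in> b \<and> b \<subseteq> A j" by (rule allI)
    then obtain b where b: "\<forall>j. b j \<in> B \<and> x $ j \<in> b j \<and> b j \<subseteq> A j"
      by (rule choice[THEN exE])
    have "b \<in> C"
      unfolding C_def using b A(2) by blast
    with b show ?thesis by blast
  qed
  then have "x \<in> W \<longleftrightarrow> (\<exists>b\<in>C. \<forall>j. x $ j \<in> b j)" for x
    unfolding C_def by blast
  then have "(\<lambda>x. \<chi> j. f j x) -` W \<inter> space M = (\<Union>b\<in>C. {x \<in> space M. \<forall>j. f j x \<in> b j})"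
    by (simp add: set_eq_iff) blast
  also have "\<dots> \<in> sets M"
  proof (intro sets.countable_UN'' cC)
    fix b assume "b \<in> C"
    then have "open (b j)" for j
      using B(2) by (auto simp: C_def PiE_def Pi_def intro: topological_basis_open)
    then have [measurable]: "b j \<in> sets borel" for j by simp
    note assms[measurable]
    show "{x \<in> space M. \<forall>j. f j x \<in> b j} \<in> sets M" by measurable
  qed
  finally show "(\<lambda>x. \<chi> j. f j x) -` W \<inter> space M \<in> sets M" .
qed

lemma borel_measurable_vec_nth_ereal [measurable]:
  "(\<lambda>x :: ereal ^ 'd::finite. x $ j) \<in> borel_measurable borel"
  by (intro borel_measurable_continuous_onI continuous_intros)

lemma distr_add_exponential:
  fixes S :: "'a \<Rightarrow> ereal ^ 'd::finite" and E :: "'a \<Rightarrow> real"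
  assumes "prob_space N"
    and S [measurable]: "S \<in> borel_measurable N"
    and E: "distributed N lborel E (exponential_density 1)"
    and indep: "\<And>A B. A \<in> sets borel \<Longrightarrow> B \<in> sets borel \<Longrightarrow>
      measure N {x \<in> space N. S x \<in> A \<and> E x \<in> B} =
      measure N {x \<in> space N. S x \<in> A} * measure N {x \<in> space N. E x \<in> B}"
  shows "distr N borel (\<lambda>x. \<chi> j. S x $ j + ereal (E x)) = GP_S (distr N borel S)"
proof -
  interpret prob_space N by fact
  have E' [measurable]: "E \<in> borel_measurable N"
    using distributed_measurable[OF E] by simp
  have D: "density lborel (exponential_density 1) = distr N borel E"
  proof -
    have "distr N lborel E = distr N borel E" by (rule distr_cong) simp_all
    then show ?thesis using distributed_distr_eq_density[OF E] by simp
  qed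
  interpret S: prob_space "distr N borel S" by (rule prob_space_distr) simp
  interpret E: prob_space "distr N borel E" by (rule prob_space_distr) simp
  have J: "distr N borel S \<Otimes>\<^sub>M distr N borel E = distr N (borel \<Otimes>\<^sub>M borel) (\<lambda>x. (S x, E x))"
  proof (rule pair_measure_eqI)
    fix A :: "(ereal ^ 'd) set" and B :: "real set"
    assume "A \<in> sets (distr N borel S)" "B \<in> sets (distr N borel E)"
    then have AB [measurable]: "A \<in> sets borel" "B \<in> sets borel" by auto
    have "S -` A \<inter> space N = {x \<in> space N. S x \<in> A}" "E -` B \<inter> space N = {x \<in> space N. E x \<in> B}"
      "(\<lambda>x. (S x, E x)) -` (A \<times> B) \<inter> space N = {x \<in> space N. S x \<in> A \<and> E x \<in> B}" by auto
    then show "emeasure (distr N borel S) A * emeasure (distr N borel E) B =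
        emeasure (distr N (borel \<Otimes>\<^sub>M borel) (\<lambda>x. (S x, E x))) (A \<times> B)"
      using indep[OF AB] by (simp add: emeasure_distr emeasure_eq_measure ennreal_mult)
  qed (simp_all add: S.sigma_finite_measure_axioms E.sigma_finite_measure_axioms cong: sets_pair_measure_cong)
  have [measurable]: "(\<lambda>(s :: ereal ^ 'd, e). \<chi> j. s $ j + ereal e) \<in> borel_measurable (borel \<Otimes>\<^sub>M borel)"
    unfolding split_beta by (intro borel_measurable_vec_lambda_ereal) measurable
  show ?thesis
    unfolding GP_S_def D J by (subst distr_distr) (auto simp: comp_def)
qed

end

theory Submission
  imports Defs
begin

text \<open>
  The law \<open>Q\<close> of \<open>S\<close> is the density \<open>w / m\<close>, with \<open>w = e\<^bsup>max U\<^esup>\<close> and \<open>m = E w\<close>, pushed forward by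
  \<open>U \<mapsto> U - max U\<close>. Conditioning on \<open>S\<close>, the event \<open>S + E \<le> z\<close> is \<open>E \<le> - max (S - z)\<close>, so
  \<open>H z = 1 - E [1 \<and> e\<^bsup>max (S - z)\<^esup>]\<close>. Multiplying by \<open>w\<close> undoes the shift, because
  \<open>e\<^bsup>S\<^sub>j\<^esup> w = e\<^bsup>U\<^sub>j\<^esup>\<close>; this gives the cdf. It has the GP form because
  \<open>w \<and> a = w + a - max w a\<close> with \<open>a = e\<^bsup>max (U - z)\<^esup>\<close>, and \<open>max w a\<close> is the maximum over \<open>j\<close> of
  \<open>e\<^bsup>U\<^sub>j - (z\<^sub>j \<and> 0)\<^esup>\<close>.
\<close>

section \<open>Maxima of vectors and the extended exponential\<close>

lemma vmax_ge: "x $ j \<le> vmax x"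
  unfolding vmax_def by (intro Max_ge) auto

lemma vmax_attained: "\<exists>j. vmax x = x $ j"
proof -
  have "vmax x \<in> range (\<lambda>j. x $ j)" unfolding vmax_def by (intro Max_in) auto
  then show ?thesis by auto
qed

lemma vmax_le_iff: "vmax x \<le> c \<longleftrightarrow> (\<forall>j. x $ j \<le> c)"
  unfolding vmax_def by (subst Max_le_iff) auto

lemma vmax_less_iff: "vmax x < c \<longleftrightarrow> (\<forall>j. x $ j < c)"
  unfolding vmax_def by (subst Max_less_iff) auto

lemma vmax_mono:
  assumes "\<And>j. x $ j \<le> y $ j"
  shows "vmax x \<le> vmax y"
  using order_trans[OF assms vmax_ge] by (simp add: vmax_le_iff)

lemma vmax_eqI:
  assumes "x $ i = c" "\<And>j. x $ j \<le> c"
  shows "vmax x = c"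
  using assms vmax_ge[of x i] by (intro antisym) (auto simp: vmax_le_iff)

lemma vmax_nonneg:
  fixes x :: "real ^ 'd::finite"
  assumes "\<And>j. 0 \<le> x $ j"
  shows "0 \<le> vmax x"
proof -
  obtain i where "vmax x = x $ i" using vmax_attained by blast
  then show ?thesis using assms by simp
qed

lemma vmax_mult_left:
  fixes c :: real
  assumes "0 \<le> c"
  shows "vmax (\<chi> j. c * x $ j) = c * vmax x"
proof -
  obtain i where i: "vmax x = x $ i" using vmax_attained by blast
  show ?thesis
  proof (rule vmax_eqI[of _ i])
    show "(\<chi> j. c * x $ j) $ j \<le> c * vmax x" for j
      using mult_left_mono[OF vmax_ge assms] by simp
  qed (simp add: i)
qed

lemma vmax_le_sum:
  fixes x :: "real ^ 'd::finite"
  assumes "\<And>j. 0 \<le> x $ j"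
  shows "vmax x \<le> (\<Sum>j\<in>UNIV. x $ j)"
  unfolding vmax_le_iff using assms by (auto intro!: member_le_sum)

text \<open>This merges \<open>w\<close> and \<open>exp (max (U - z))\<close>, two maxima over the
  same index set, into one maximum over coordinates.\<close>

lemma vmax_max: "vmax (\<chi> j. max (x $ j) (y $ j)) = max (vmax x) (vmax y)"
proof (rule antisym)
  show "vmax (\<chi> j. max (x $ j) (y $ j)) \<le> max (vmax x) (vmax y)"
    by (simp only: vmax_le_iff vec_lambda_beta) (blast intro: max.mono vmax_ge)
  show "max (vmax x) (vmax y) \<le> vmax (\<chi> j. max (x $ j) (y $ j))"
    by (auto intro!: vmax_mono)
qed

section \<open>Measurability of maxima and of vectors given by coordinates\<close>

lemma borel_measurable_vmax:
  fixes f :: "'d::finite \<Rightarrow> 'a \<Rightarrow> 'b::{second_countable_topology, linorder_topology}"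
  assumes "\<And>j. f j \<in> borel_measurable M"
  shows "(\<lambda>x. vmax (\<chi> j. f j x)) \<in> borel_measurable M"
  unfolding vmax_def using borel_measurable_Max[of UNIV f M] assms by simp

lemma borel_measurable_vmax_ereal [measurable]:
  "vmax \<in> borel_measurable (borel :: (ereal ^ 'd::finite) measure)"
proof -
  have "(\<lambda>x :: ereal ^ 'd. vmax (\<chi> j. x $ j)) \<in> borel_measurable borel"
    by (intro borel_measurable_vmax) measurable
  then show ?thesis by (simp add: vec_lambda_eta)
qed

text \<open>The space \<open>real ^ 'd\<close> is Euclidean, so measurability can be tested on inner
  products with basis vectors, and these are the coordinates.\<close>

lemma borel_measurable_vec_lambda_real:
  fixes f :: "'d::finite \<Rightarrow> 'a \<Rightarrow> real"
  assumes "\<And>j. f j \<in> borel_measurable M"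
  shows "(\<lambda>x. \<chi> j. f j x) \<in> borel_measurable M"
proof (rule borel_measurable_euclidean_space[THEN iffD2], rule ballI)
  fix b :: "real ^ 'd" assume "b \<in> Basis"
  then obtain i where b: "b = axis i 1" by (auto simp: Basis_vec_def)
  have "(\<chi> j. f j x) \<bullet> b = f i x" for x by (simp add: b inner_axis)
  then show "(\<lambda>x. (\<chi> j. f j x) \<bullet> b) \<in> borel_measurable M" by (simp only: assms)
qed

lemma borel_measurable_vec_nth_real [measurable]:
  "(\<lambda>x :: real ^ 'd::finite. x $ j) \<in> borel_measurable borel"
  by (intro borel_measurable_continuous_onI continuous_intros)

section \<open>The extended exponential\<close>

lemma eexp_nonneg [simp]: "0 \<le> eexp x"
  by (simp add: eexp_def)

lemma eexp_pos_iff [simp]: "0 < eexp x \<longleftrightarrow> x \<noteq> -\<infinity>"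
  by (simp add: eexp_def)

lemma eexp_ereal [simp]: "eexp (ereal r) = exp r"
  by (simp add: eexp_def)

text \<open>The bound on \<open>y\<close> matters: \<open>real_of_ereal\<close> sends \<infinity> to
  0, so \<open>eexp \<infinity>\<close> is 1 and monotonicity breaks at the top.\<close>

lemma eexp_mono: "x \<le> y \<Longrightarrow> y < \<infinity> \<Longrightarrow> eexp x \<le> eexp y"
  by (cases x; cases y) (auto simp: eexp_def)

lemma borel_measurable_eexp [measurable]: "eexp \<in> borel_measurable borel"
  unfolding eexp_def[abs_def] by measurable

lemma eexp_diff_ereal: "x < \<infinity> \<Longrightarrow> eexp (x - ereal z) = exp (- z) * eexp x"
  by (cases x) (auto simp: eexp_def simp flip: exp_add)

lemma eexp_diff_mult: "x < \<infinity> \<Longrightarrow> y < \<infinity> \<Longrightarrow> y \<noteq> -\<infinity> \<Longrightarrow> eexp (x - y) * eexp y = eexp x"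
  by (cases x; cases y) (auto simp: eexp_def simp flip: exp_add)

text \<open>A monotone function commutes with a finite maximum; the hypothesis keeps all coordinates
  in the range where \<open>eexp\<close> is monotone.\<close>

lemma eexp_vmax:
  assumes "\<And>j. x $ j < \<infinity>"
  shows "eexp (vmax x) = vmax (\<chi> j. eexp (x $ j))"
proof -
  obtain i where "vmax x = x $ i" using vmax_attained by blast
  then show ?thesis
    using assms vmax_ge[of x] by (intro vmax_eqI[symmetric, of _ i]) (auto intro: eexp_mono)
qed

text \<open>This trades a maximum of extended reals for a maximum of nonnegative reals with weights,
  from which common factors can be pulled out.\<close>

lemma eexp_vmax_diff:
  assumes "\<And>j. x $ j < \<infinity>"
  shows "eexp (vmax (\<chi> j. x $ j - ereal (z $ j))) = vmax (\<chi> j. exp (- (z $ j)) * eexp (x $ j))"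
proof -
  have "x $ j - ereal (z $ j) < \<infinity>" for j using assms[of j] by (cases "x $ j") auto
  then show ?thesis using assms by (subst eexp_vmax) (auto simp: eexp_diff_ereal)
qed

section \<open>Stable tail dependence functions\<close>

lemma is_stdfE:
  fixes l :: "real ^ 'd::finite \<Rightarrow> real"
  assumes "is_stdf l"
  obtains \<nu> :: "(real ^ 'd) measure" where
    "sets \<nu> = sets borel" "AE v in \<nu>. \<forall>j. 0 \<le> v $ j" "\<And>j. (\<integral>v. v $ j \<partial>\<nu>) = 1"
    "\<And>y. (\<And>j. 0 \<le> y $ j) \<Longrightarrow> l y = (\<integral>v. vmax (\<chi> j. y $ j * v $ j) \<partial>\<nu>)"
  using assms unfolding is_stdf_def by blast

text \<open>The factor \<open>c\<close> leaves first the maximum, pointwise, and then the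
  integral.\<close>

lemma is_stdf_homogeneous:
  assumes l: "is_stdf l" and y: "\<And>j. 0 \<le> y $ j" and c: "0 \<le> c"
  shows "l (\<chi> j. c * y $ j) = c * l y"
proof -
  obtain \<nu> :: "(real ^ 'a) measure" where
    \<nu>: "\<And>y. (\<And>j. 0 \<le> y $ j) \<Longrightarrow> l y = (\<integral>v. vmax (\<chi> j. y $ j * v $ j) \<partial>\<nu>)"
    using is_stdfE[OF l] by metis
  have "vmax (\<chi> j. c * y $ j * v $ j) = c * vmax (\<chi> j. y $ j * v $ j)" for v :: "real ^ 'a"
    using vmax_mult_left[OF c, of "\<chi> j. y $ j * v $ j"] by (simp add: mult.assoc)
  then show ?thesis using y c by (subst (1 2) \<nu>) auto
qed

text \<open>Almost surely the maximum is attained at coordinate \<open>i\<close>, the others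
  contributing 0, and the mean of that coordinate is 1.\<close>

lemma is_stdf_axis:
  assumes l: "is_stdf l" and c: "0 \<le> c"
  shows "l (axis i c) = c"
proof -
  obtain \<nu> :: "(real ^ 'a) measure" where
    s: "sets \<nu> = sets borel" and pos: "AE v in \<nu>. \<forall>j. 0 \<le> v $ j" and E: "\<And>j. (\<integral>v. v $ j \<partial>\<nu>) = 1" and
    \<nu>: "\<And>y. (\<And>j. 0 \<le> y $ j) \<Longrightarrow> l y = (\<integral>v. vmax (\<chi> j. y $ j * v $ j) \<partial>\<nu>)"
    by (rule is_stdfE[OF l]) blast
  note [measurable_cong] = s
  have "(\<integral>v. vmax (\<chi> j. axis i c $ j * v $ j) \<partial>\<nu>) = (\<integral>v. c * v $ i \<partial>\<nu>)"
  proof (rule integral_cong_AE)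
    show "AE v in \<nu>. vmax (\<chi> j. axis i c $ j * v $ j) = c * v $ i"
      using pos by eventually_elim (auto intro!: vmax_eqI[of _ i] simp: axis_def c)
  qed (auto intro!: borel_measurable_vmax)
  then show ?thesis using E c by (subst \<nu>) (auto simp: axis_def)
qed

text \<open>Together the two bounds give continuity under coordinatewise increases, which is all
  that the passage from the open to the closed orthant requires.\<close>

lemma is_stdf_increment:
  assumes l: "is_stdf l" and y: "\<And>j. 0 \<le> y $ j" and h: "\<And>j. 0 \<le> h $ j"
  shows "l y \<le> l (y + h)" "l (y + h) \<le> l y + (\<Sum>j\<in>UNIV. h $ j)"
proof -
  obtain \<nu> :: "(real ^ 'a) measure" where
    s: "sets \<nu> = sets borel" and pos: "AE v in \<nu>. \<forall>j. 0 \<le> v $ j" and E: "\<And>j. (\<integral>v. v $ j \<partial>\<nu>) = 1" and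
    \<nu>: "\<And>y. (\<And>j. 0 \<le> y $ j) \<Longrightarrow> l y = (\<integral>v. vmax (\<chi> j. y $ j * v $ j) \<partial>\<nu>)"
    by (rule is_stdfE[OF l]) blast
  note [measurable_cong] = s
  \<comment> \<open>A function that is not integrable has Bochner integral 0, so mean 1 forces
    integrability.\<close>
  have int: "integrable \<nu> (\<lambda>v. v $ j)" for j
    using E not_integrable_integral_eq by fastforce
  have intmax: "integrable \<nu> (\<lambda>v. vmax (\<chi> j. y $ j * v $ j))" if "\<And>j. 0 \<le> y $ j" for y :: "real ^ 'a"
  proof (rule Bochner_Integration.integrable_bound)
    show "integrable \<nu> (\<lambda>v. \<Sum>j\<in>UNIV. y $ j * v $ j)" using int by simp
    show "AE v in \<nu>. norm (vmax (\<chi> j. y $ j * v $ j)) \<le> norm (\<Sum>j\<in>UNIV. y $ j * v $ j)"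
      using pos
    proof eventually_elim
      case (elim v)
      then have "0 \<le> (\<chi> j. y $ j * v $ j) $ j" for j using that by simp
      from vmax_nonneg[OF this] vmax_le_sum[OF this] show ?case by simp
    qed
  qed (auto intro!: borel_measurable_vmax)
  have yh: "0 \<le> (y + h) $ j" for j using y h by simp
  show "l y \<le> l (y + h)"
    unfolding \<nu>[OF y] \<nu>[OF yh]
  proof (rule integral_mono_AE[OF intmax intmax, OF y yh])
    show "AE v in \<nu>. vmax (\<chi> j. y $ j * v $ j) \<le> vmax (\<chi> j. (y + h) $ j * v $ j)"
      using pos by eventually_elim (auto intro!: vmax_mono mult_right_mono simp: h)
  qed
  have "l (y + h) \<le> (\<integral>v. vmax (\<chi> j. y $ j * v $ j) + (\<Sum>j\<in>UNIV. h $ j * v $ j) \<partial>\<nu>)"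
    unfolding \<nu>[OF yh]
  proof (rule integral_mono_AE[OF intmax])
    show "AE v in \<nu>. vmax (\<chi> j. (y + h) $ j * v $ j)
        \<le> vmax (\<chi> j. y $ j * v $ j) + (\<Sum>j\<in>UNIV. h $ j * v $ j)"
      using pos
    proof eventually_elim
      case (elim v)
      have "(y + h) $ j * v $ j \<le> vmax (\<chi> j. y $ j * v $ j) + (\<Sum>j\<in>UNIV. h $ j * v $ j)" for j
      proof -
        have "y $ j * v $ j \<le> vmax (\<chi> j. y $ j * v $ j)"
          using vmax_ge[of "\<chi> j. y $ j * v $ j" j] by simp
        moreover have "h $ j * v $ j \<le> (\<Sum>j\<in>UNIV. h $ j * v $ j)"
          using elim h by (intro member_le_sum) auto
        ultimately show ?thesis by (simp add: distrib_right)
      qed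
      then show ?case by (simp add: vmax_le_iff)
    qed
  qed (use yh int intmax[OF y] in auto)
  also have "\<dots> = l y + (\<Sum>j\<in>UNIV. h $ j)"
    using int intmax[OF y] E by (simp add: \<nu>[OF y])
  finally show "l (y + h) \<le> l y + (\<Sum>j\<in>UNIV. h $ j)" .
qed

text \<open>On \<open>z \<ge> 0\<close> the cdf of \<open>GP(1, 0, p, l)\<close> is \<open>1 - l (p e\<^sup>-\<^sup>z)\<close>, which gives \<open>l\<close> on the box
  below \<open>p\<close>. Homogeneity and continuity extend this to the orthant, and the
  value \<open>l (p\<^sub>j e\<^sub>j) = p\<^sub>j\<close> on the axes recovers \<open>p\<close>.\<close>

lemma is_GP_unique:
  assumes 1: "is_GP G p l" and 2: "is_GP G q k"
  shows "p = q" "\<And>y. (\<And>j. 0 \<le> y $ j) \<Longrightarrow> l y = k y"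
proof -
  have p: "0 < p $ j" and q: "0 < q $ j" for j using 1 2 by (auto simp: is_GP_def)
  have l: "is_stdf l" and k: "is_stdf k" using 1 2 by (auto simp: is_GP_def)
  have box: "l (\<chi> j. p $ j * u $ j) = k (\<chi> j. q $ j * u $ j)"
    if u: "\<And>j. 0 < u $ j" "\<And>j. u $ j \<le> 1" for u
  proof -
    \<comment> \<open>Since \<open>u\<close> is at most 1, this \<open>z\<close> is nonnegative. The
      first term of each cdf is then the value at the parameter vector itself, namely 1, and
      cancels.\<close>
    define z where "z = (\<chi> j. - ln (u $ j))"
    have z: "min (z $ j) 0 = 0" "exp (- (z $ j)) = u $ j" for j
      using u[of j] by (auto simp: z_def)
    have "l (\<chi> j. p $ j * exp (- min (z $ j) 0)) - l (\<chi> j. p $ j * exp (- (z $ j)))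
        = k (\<chi> j. q $ j * exp (- min (z $ j) 0)) - k (\<chi> j. q $ j * exp (- (z $ j)))"
      using 1 2 unfolding is_GP_def by metis
    then show ?thesis
      using 1 2 unfolding z by (simp add: is_GP_def)
  qed
  have pos: "l (\<chi> j. p $ j * u $ j) = k (\<chi> j. q $ j * u $ j)" if u: "\<And>j. 0 < u $ j" for u
  proof -
    \<comment> \<open>Dividing by the largest coordinate moves \<open>u\<close> into the box;
      homogeneity moves the identity back.\<close>
    define c where "c = vmax u"
    have c: "0 < c" "\<And>j. u $ j \<le> c"
      using u vmax_attained[of u] vmax_ge[of u] unfolding c_def by (metis, metis)
    define v where "v = (\<chi> j. u $ j / c)"
    have v: "0 < v $ j" "v $ j \<le> 1" "u $ j = c * v $ j" for j
      using u[of j] c(1) c(2)[of j] by (auto simp: v_def)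
    have "l (\<chi> j. c * (\<chi> j. p $ j * v $ j) $ j) = k (\<chi> j. c * (\<chi> j. q $ j * v $ j) $ j)"
      using box[OF v(1,2)] c p q v
      by (subst (1 2) is_stdf_homogeneous) (auto simp: l k less_imp_le)
    then show ?thesis by (simp add: v(3) mult.left_commute)
  qed
  have nonneg: "l (\<chi> j. p $ j * u $ j) = k (\<chi> j. q $ j * u $ j)" if u: "\<And>j. 0 \<le> u $ j" for u
  proof -
    \<comment> \<open>The boundary of the orthant is reached by adding \<open>e\<close> to all
      coordinates and letting \<open>e\<close> decrease to 0, squeezed by the increment
      bounds.\<close>
    have lim: "((\<lambda>e. f (\<chi> j. r $ j * (u $ j + e))) \<longlongrightarrow> f (\<chi> j. r $ j * u $ j)) (at_right 0)"
      if f: "is_stdf f" and r: "\<And>j. 0 < r $ j" for f :: "real ^ 'a \<Rightarrow> real" and r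
    proof (rule tendsto_sandwich)
      have bounds: "f (\<chi> j. r $ j * u $ j) \<le> f (\<chi> j. r $ j * (u $ j + e)) \<and>
          f (\<chi> j. r $ j * (u $ j + e)) \<le> f (\<chi> j. r $ j * u $ j) + (\<Sum>j\<in>UNIV. r $ j * e)"
        if "0 < e" for e
      proof -
        have eq: "(\<chi> j. r $ j * (u $ j + e)) = (\<chi> j. r $ j * u $ j) + (\<chi> j. r $ j * e)"
          by (simp add: vec_eq_iff distrib_left)
        have "0 \<le> (\<chi> j. r $ j * u $ j) $ j" "0 \<le> (\<chi> j. r $ j * e) $ j" for j
          using r[of j] u[of j] that by simp_all
        from is_stdf_increment[OF f this] show ?thesis unfolding eq by simp
      qed
      show "\<forall>\<^sub>F e in at_right 0. f (\<chi> j. r $ j * u $ j) \<le> f (\<chi> j. r $ j * (u $ j + e))"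
        "\<forall>\<^sub>F e in at_right 0. f (\<chi> j. r $ j * (u $ j + e))
          \<le> f (\<chi> j. r $ j * u $ j) + (\<Sum>j\<in>UNIV. r $ j * e)"
        using bounds by (auto simp: eventually_at_right_less intro!: eventually_at_rightI[of 0 1])
      show "((\<lambda>e. f (\<chi> j. r $ j * u $ j) + (\<Sum>j\<in>UNIV. r $ j * e))
          \<longlongrightarrow> f (\<chi> j. r $ j * u $ j)) (at_right 0)"
        by (auto intro!: tendsto_eq_intros)
    qed simp
    have "\<forall>\<^sub>F e in at_right 0. l (\<chi> j. p $ j * (u $ j + e)) = k (\<chi> j. q $ j * (u $ j + e))"
    proof (rule eventually_at_rightI)
      fix e :: real assume "e \<in> {0<..<1}"
      then have "0 < (\<chi> j. u $ j + e) $ j" for j using u[of j] by simp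
      from pos[OF this] show "l (\<chi> j. p $ j * (u $ j + e)) = k (\<chi> j. q $ j * (u $ j + e))" by simp
    qed simp
    from tendsto_cong[OF this] lim[OF l p] have
      "((\<lambda>e. k (\<chi> j. q $ j * (u $ j + e))) \<longlongrightarrow> l (\<chi> j. p $ j * u $ j)) (at_right 0)" by simp
    from tendsto_unique[OF _ this lim[OF k q]] show ?thesis by simp
  qed
  have "p $ i = q $ i" for i
  proof -
    have ax: "(\<chi> j. r $ j * axis i 1 $ j) = axis i (r $ i)" for r :: "real ^ 'a"
      by (simp add: vec_eq_iff axis_def)
    have "l (axis i (p $ i)) = k (axis i (q $ i))"
      using nonneg[of "axis i 1"] unfolding ax by (simp add: axis_def)
    then show ?thesis using p[of i] q[of i] by (simp add: is_stdf_axis l k less_imp_le)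
  qed
  then show pq: "p = q" by (simp add: vec_eq_iff)
  show "l y = k y" if y: "\<And>j. 0 \<le> y $ j" for y
  proof -
    \<comment> \<open>Division by the positive vector \<open>p\<close>, now known to equal
      \<open>q\<close>, writes every \<open>y\<close> in the orthant as a product \<open>p u\<close>
      with nonnegative \<open>u\<close>.\<close>
    have "q $ j \<noteq> 0" for j using q[of j] by simp
    then show ?thesis
      using nonneg[of "\<chi> j. y $ j / p $ j"] y p by (simp add: pq less_imp_le)
  qed
qed

section \<open>Adding an independent exponential variable\<close>

abbreviation (input) expo :: "real measure" where
  "expo \<equiv> density lborel (exponential_density 1)"

lemma prob_space_expo: "prob_space expo"
  by (rule prob_space_exponential_density) simp

text \<open>The truncation by \<open>min 1\<close> covers negative \<open>a\<close>, where the cdf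
  is 0. With \<open>a = - max (s - z)\<close> it becomes the truncation in the formula for the cdf
  of S + E.\<close>

lemma emeasure_expo_le: "emeasure expo {..a} = ennreal (1 - min 1 (exp (- a)))"
  by (subst emeasure_erlang_density) (auto simp: erlang_CDF_def)

lemma GP_S_measurable:
  assumes [measurable_cong]: "sets Q = sets borel"
  shows "(\<lambda>(s, e). \<chi> j. s $ j + ereal e) \<in> borel_measurable (Q \<Otimes>\<^sub>M expo)"
  unfolding split_beta by (intro borel_measurable_vec_lambda_ereal) measurable

lemma prob_space_GP_S:
  assumes "prob_space Q" "sets Q = sets borel"
  shows "prob_space (GP_S Q)"
proof -
  interpret Q: prob_space Q by fact
  interpret E: prob_space expo by (rule prob_space_expo)
  interpret pair_prob_space Q expo ..
  show ?thesis unfolding GP_S_def by (rule prob_space_distr[OF GP_S_measurable[OF assms(2)]])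
qed

text \<open>A coordinate of \<open>s\<close> that attains the maximum 0 becomes positive once a
  positive \<open>e\<close> is added, and no coordinate reaches \<infinity>.\<close>

lemma AE_GP_S:
  assumes "prob_space Q" and s [measurable_cong]: "sets Q = sets borel"
    and Q: "AE s in Q. (\<forall>j. s $ j \<le> 0) \<and> vmax s = 0"
  shows "AE x in GP_S Q. (\<forall>j. x $ j < \<infinity>) \<and> \<not> (\<forall>j. x $ j \<le> 0)"
proof -
  interpret Q: prob_space Q by fact
  interpret E: prob_space expo by (rule prob_space_expo)
  interpret pair_prob_space Q expo ..
  have E: "AE e in expo. 0 < e"
  proof -
    \<comment> \<open>The density vanishes on negative numbers, so only the null set {0} remains to
      be discarded.\<close>
    have "AE e in lborel. e \<noteq> (0::real)" by (rule AE_lborel_singleton)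
    then show ?thesis
      by (subst AE_density) (auto simp: exponential_density_def split: if_splits elim!: eventually_mono)
  qed
  have "AE x in Q \<Otimes>\<^sub>M expo. (\<forall>j. fst x $ j + ereal (snd x) < \<infinity>) \<and> \<not> (\<forall>j. fst x $ j + ereal (snd x) \<le> 0)"
  proof (rule AE_pair_measure)
    show "AE x in Q. AE y in expo. (\<forall>j. fst (x, y) $ j + ereal (snd (x, y)) < \<infinity>) \<and>
        \<not> (\<forall>j. fst (x, y) $ j + ereal (snd (x, y)) \<le> 0)"
      using Q
    proof eventually_elim
      case s: (elim s)
      obtain i where i: "s $ i = 0" using vmax_attained[of s] s by metis
      have fin: "s $ j + ereal e < \<infinity>" for j e
      proof -
        have "s $ j \<le> 0" using s by simp
        then show ?thesis by (cases "s $ j") auto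
      qed
      show ?case using E
      proof eventually_elim
        case (elim e)
        have "\<not> s $ i + ereal e \<le> 0" using elim i by simp
        then show ?case using fin by auto
      qed
    qed
  qed measurable
  then show ?thesis
    unfolding GP_S_def by (subst AE_distr_iff[OF GP_S_measurable[OF s]]) (auto simp: split_beta)
qed

text \<open>By Fubini it suffices to measure the slice at each fixed \<open>s\<close>, which is a
  half-line or the whole line.\<close>

lemma cdf_GP_S:
  assumes "prob_space Q" and s [measurable_cong]: "sets Q = sets borel"
    and Q: "AE s in Q. \<forall>j. s $ j < \<infinity>"
  shows "measure (GP_S Q) {x. \<forall>j. x $ j \<le> ereal (z $ j)}
    = 1 - (\<integral>s. min 1 (eexp (vmax (\<chi> j. s $ j - ereal (z $ j)))) \<partial>Q)"
proof -
  interpret Q: prob_space Q by fact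
  interpret E: prob_space expo by (rule prob_space_expo)
  let ?B = "{x :: ereal ^ 'a. \<forall>j. x $ j \<le> ereal (z $ j)}"
  let ?r = "\<lambda>s :: ereal ^ 'a. vmax (\<chi> j. s $ j - ereal (z $ j))"
  let ?A = "{y. \<forall>j. fst y $ j + ereal (snd y) \<le> ereal (z $ j)} :: ((ereal ^ 'a) \<times> real) set"
  have B: "?B \<in> sets borel" by measurable
  have [measurable]: "?r \<in> borel_measurable Q" by (intro borel_measurable_vmax) measurable
  have spQ: "space Q = UNIV" using sets_eq_imp_space_eq[OF s] by simp
  have A: "?A \<in> sets (Q \<Otimes>\<^sub>M expo)"
  proof -
    have "{y \<in> space (Q \<Otimes>\<^sub>M expo). \<forall>j. fst y $ j + ereal (snd y) \<le> ereal (z $ j)} \<in> sets (Q \<Otimes>\<^sub>M expo)"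
      by measurable
    then show ?thesis by (simp add: space_pair_measure spQ)
  qed
  have "emeasure (GP_S Q) ?B = emeasure (Q \<Otimes>\<^sub>M expo) ?A"
    unfolding GP_S_def
    by (subst emeasure_distr[OF GP_S_measurable[OF s] B])
      (auto intro!: arg_cong[where f = "emeasure _"] simp: space_pair_measure spQ)
  also have "\<dots> = (\<integral>\<^sup>+s. emeasure expo (Pair s -` ?A) \<partial>Q)"
    by (rule E.emeasure_pair_measure_alt[OF A])
  also have "\<dots> = (\<integral>\<^sup>+s. ennreal (1 - min 1 (eexp (?r s))) \<partial>Q)"
  proof (rule nn_integral_cong_AE)
    show "AE s in Q. emeasure expo (Pair s -` ?A) = ennreal (1 - min 1 (eexp (?r s)))"
      using Q
    proof eventually_elim
      case (elim s)
      have "s $ j - ereal (z $ j) < \<infinity>" for j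
        using elim by (cases "s $ j") (auto dest: spec[of _ j])
      then have fin: "?r s < \<infinity>" 
        using vmax_less_iff[of "\<chi> j. s $ j - ereal (z $ j)" \<infinity>] by simp
      have shift: "a + ereal e \<le> ereal b \<longleftrightarrow> a - ereal b \<le> ereal (- e)" for a b e
        by (cases a) auto
      have slice: "Pair s -` ?A = {e. ?r s \<le> ereal (- e)}"
        by (auto simp: vmax_le_iff shift)
      show ?case
      proof (cases "?r s")
        case (real t)
        then have "Pair s -` ?A = {..- t}" unfolding slice by auto
        then show ?thesis using emeasure_expo_le[of "- t"] real by simp
      next
        case MInf
        then have "Pair s -` ?A = UNIV" unfolding slice by auto
        then show ?thesis using MInf E.emeasure_space_1 by (simp add: eexp_def)
      qed (use fin in simp)
    qed
  qed
  also have "\<dots> = ennreal (\<integral>s. 1 - min 1 (eexp (?r s)) \<partial>Q)"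
    by (intro nn_integral_eq_integral Q.integrable_const_bound[of _ 1]) auto
  also have "(\<integral>s. 1 - min 1 (eexp (?r s)) \<partial>Q) = 1 - (\<integral>s. min 1 (eexp (?r s)) \<partial>Q)"
  proof -
    have "integrable Q (\<lambda>s. min 1 (eexp (?r s)))"
      by (intro Q.integrable_const_bound[of _ 1]) auto
    then show ?thesis by (simp add: Q.prob_space)
  qed
  finally show ?thesis
    by (simp add: measure_def integral_nonneg_AE Q.integral_le_const Q.integrable_const_bound[of _ 1])
qed


section \<open>The spectral law of a random vector\<close>

locale exponentially_integrable = prob_space M for M :: "'a measure" +
  fixes U :: "'a \<Rightarrow> ereal ^ 'd::finite"
  assumes U [measurable]: "U \<in> borel_measurable M"
    and U_less_top: "x \<in> space M \<Longrightarrow> U x $ j < \<infinity>"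
    and integrable_eexp_U: "integrable M (\<lambda>x. eexp (U x $ j))"
    and integral_eexp_U_pos: "0 < (\<integral>x. eexp (U x $ j) \<partial>M)"
begin

definition w :: "'a \<Rightarrow> real" where
  "w x = eexp (vmax (U x))"

definition m :: real where
  "m = (\<integral>x. w x \<partial>M)"

text \<open>Where the maximum of U is -\<infinity>, the coordinates are values of -\<infinity> -
  (-\<infinity>) without meaning; the weight \<open>w\<close> is 0 there.\<close>

definition shifted :: "'a \<Rightarrow> ereal ^ 'd" where
  "shifted x = (\<chi> j. U x $ j - vmax (U x))"

text \<open>As the image of a reweighted probability measure, the prescribed law exists without
  further argument.\<close>

definition spectral_law :: "(ereal ^ 'd) measure" where
  "spectral_law = distr (density M (\<lambda>x. ennreal (w x / m))) borel shifted"

section \<open>The weight, its integrability and its mean\<close>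

lemma w_measurable [measurable]: "w \<in> borel_measurable M"
  unfolding w_def[abs_def] by measurable

lemma shifted_measurable [measurable]: "shifted \<in> borel_measurable M"
  unfolding shifted_def[abs_def] by (intro borel_measurable_vec_lambda_ereal) measurable

lemma w_nonneg [simp]: "0 \<le> w x"
  by (simp add: w_def)

lemma w_eq_vmax: "x \<in> space M \<Longrightarrow> w x = vmax (\<chi> j. eexp (U x $ j))"
  unfolding w_def by (rule eexp_vmax) (rule U_less_top)

lemma vmax_U_less_top: "x \<in> space M \<Longrightarrow> vmax (U x) < \<infinity>"
  unfolding vmax_less_iff by (simp only: U_less_top) simp

text \<open>A maximum of nonnegative numbers is at most their sum. The choice \<open>c = 1\<close>
  serves \<open>w\<close>, and \<open>c = exp (- z)\<close> serves
  \<open>exp (max (U - z))\<close>.\<close>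

lemma integrable_vmax_eexp_U:
  assumes "\<And>j. 0 \<le> c $ j"
  shows "integrable M (\<lambda>x. vmax (\<chi> j. c $ j * eexp (U x $ j)))"
proof (rule Bochner_Integration.integrable_bound)
  show "integrable M (\<lambda>x. \<Sum>j\<in>UNIV. c $ j * eexp (U x $ j))"
    using integrable_eexp_U by simp
  have nonneg: "0 \<le> (\<chi> j. c $ j * eexp (U x $ j)) $ j" for x j using assms by simp
  show "AE x in M. norm (vmax (\<chi> j. c $ j * eexp (U x $ j)))
      \<le> norm (\<Sum>j\<in>UNIV. c $ j * eexp (U x $ j))"
    using order_trans[OF vmax_le_sum[OF nonneg] abs_ge_self] vmax_nonneg[OF nonneg]
    by (intro AE_I2) simp
qed (intro borel_measurable_vmax, measurable)

lemma integrable_w: "integrable M w"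
  using integrable_vmax_eexp_U[of "\<chi> j. 1"] w_eq_vmax
  by (simp cong: Bochner_Integration.integrable_cong)

text \<open>From \<open>eexp (U x $ j) \<le> w x\<close>. The bound yields both the positivity of
  \<open>m\<close> and the admissibility condition that \<pi> is at most 1.\<close>

lemma integral_eexp_U_le_m: "(\<integral>x. eexp (U x $ j) \<partial>M) \<le> m"
  unfolding m_def
proof (rule integral_mono[OF integrable_eexp_U integrable_w])
  fix x assume "x \<in> space M"
  then show "eexp (U x $ j) \<le> w x"
    unfolding w_def by (intro eexp_mono vmax_ge vmax_U_less_top)
qed

lemma m_pos: "0 < m"
  using integral_eexp_U_pos integral_eexp_U_le_m by (rule less_le_trans)

lemma prob_space_spectral_law: "prob_space spectral_law"
proof -
  have "emeasure (density M (\<lambda>x. ennreal (w x / m))) (space M) = (\<integral>\<^sup>+x. ennreal (w x / m) \<partial>M)"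
    by (simp add: emeasure_density cong: nn_integral_cong)
  also have "\<dots> = ennreal (\<integral>x. w x / m \<partial>M)"
    using integrable_w m_pos by (intro nn_integral_eq_integral) auto
  also have "\<dots> = 1" using m_pos by (simp add: m_def[symmetric])
  finally have "prob_space (density M (\<lambda>x. ennreal (w x / m)))"
    by (intro prob_spaceI) simp
  then show ?thesis
    unfolding spectral_law_def by (rule prob_space.prob_space_distr) simp
qed

section \<open>Integrals and null sets under the spectral law\<close>

lemma sets_spectral_law [measurable_cong, simp]: "sets spectral_law = sets borel"
  by (simp add: spectral_law_def)

text \<open>Change of variables for the image measure, followed by the density; expectations over S
  thus become expectations over U.\<close>

lemma integral_spectral_law:
  fixes f :: "ereal ^ 'd \<Rightarrow> real"
  assumes [measurable]: "f \<in> borel_measurable borel"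
  shows "(\<integral>s. f s \<partial>spectral_law) = (\<integral>x. f (shifted x) * w x \<partial>M) / m"
proof -
  have "(\<integral>s. f s \<partial>spectral_law) = (\<integral>x. (w x / m) * f (shifted x) \<partial>M)"
    unfolding spectral_law_def using m_pos
    by (simp add: integral_distr integral_density)
  also have "\<dots> = (\<integral>x. (f (shifted x) * w x) / m \<partial>M)"
    by (simp add: mult.commute)
  finally show ?thesis by simp
qed

text \<open>Points of weight 0 are null for the reweighted measure, so only those with a finite
  maximum of U have to be examined.\<close>

lemma AE_spectral_law:
  assumes "{s. P s} \<in> sets borel" and "\<And>x. x \<in> space M \<Longrightarrow> 0 < w x \<Longrightarrow> P (shifted x)"
  shows "AE s in spectral_law. P s"
  unfolding spectral_law_def using assms m_pos
  by (subst AE_distr_iff) (auto simp: AE_density zero_less_divide_iff intro!: AE_I2)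

lemma measure_spectral_law:
  assumes [measurable]: "A \<in> sets borel"
  shows "measure spectral_law A = spectral_prob M U A"
proof -
  have "measure spectral_law A = (\<integral>s. indicator A s \<partial>spectral_law)" by simp
  also have "\<dots> = (\<integral>x. indicator A (shifted x) * w x \<partial>M) / m"
    by (rule integral_spectral_law) measurable
  finally show ?thesis by (simp add: spectral_prob_def shifted_def w_def m_def)
qed

text \<open>Multiplication by the weight cancels the shift. If the maximum of U is -\<infinity>,
  both sides are 0 whatever \<open>shifted\<close> is.\<close>

lemma eexp_shifted:
  assumes "x \<in> space M"
  shows "eexp (shifted x $ j) * w x = eexp (U x $ j)"
proof (cases "vmax (U x) = -\<infinity>")
  case True
  then have "U x $ j = -\<infinity>" using vmax_ge[of "U x" j] by simp
  then show ?thesis using True by (simp add: w_def eexp_def)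
next
  case False
  then show ?thesis
    using eexp_diff_mult[OF U_less_top vmax_U_less_top] assms by (simp add: w_def shifted_def)
qed

text \<open>Positive weight makes the maximum of U a real number, so the subtraction is genuine and
  sends a maximal coordinate to 0.\<close>

lemma shifted_le_0:
  assumes "x \<in> space M" "0 < w x"
  shows "shifted x $ j \<le> 0" "vmax (shifted x) = 0"
proof -
  obtain a where a: "vmax (U x) = ereal a"
    using assms vmax_U_less_top[of x] by (cases "vmax (U x)") (auto simp: w_def)
  show *: "shifted x $ j \<le> 0" for j
    using vmax_ge[of "U x" j] by (cases "U x $ j") (auto simp: shifted_def a)
  obtain i where "vmax (U x) = U x $ i" using vmax_attained by blast
  then have "U x $ i = ereal a" using a by simp
  then have "shifted x $ i = 0" by (simp add: shifted_def a)
  then show "vmax (shifted x) = 0" using * by (rule vmax_eqI)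
qed

lemma AE_spectral_law_support: "AE s in spectral_law. (\<forall>j. s $ j \<le> 0) \<and> vmax s = 0"
  by (rule AE_spectral_law) (measurable, auto intro: shifted_le_0)

lemma integral_eexp_spectral_law:
  "(\<integral>s. eexp (s $ j) \<partial>spectral_law) = (\<integral>x. eexp (U x $ j) \<partial>M) / m"
  by (subst integral_spectral_law)
    (auto simp: eexp_shifted intro!: arg_cong2[where f = "(/)"] Bochner_Integration.integral_cong)

text \<open>If S had coordinate \<open>j\<close> equal to -\<infinity> almost surely, its
  exponential would have mean 0, whereas this mean is a positive multiple of that of
  \<open>eexp (U x $ j)\<close>.\<close>

lemma measure_spectral_law_finite_pos: "0 < measure spectral_law {s. s $ j > -\<infinity>}"
proof (rule ccontr)
  interpret Q: prob_space spectral_law by (rule prob_space_spectral_law)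
  have meas: "{s :: ereal ^ 'd. s $ j > -\<infinity>} \<in> sets spectral_law" by measurable
  assume "\<not> 0 < measure spectral_law {s. s $ j > -\<infinity>}"
  then have "measure spectral_law {s. s $ j > -\<infinity>} = 0" by (simp add: zero_less_measure_iff)
  then have "AE s in spectral_law. s \<notin> {s. s $ j > -\<infinity>}"
    using Q.prob_eq_0[OF meas] by simp
  then have "AE s in spectral_law. eexp (s $ j) = 0"
    by eventually_elim (simp add: eexp_def)
  then have "(\<integral>s. eexp (s $ j) \<partial>spectral_law) = 0"
    by (rule integral_eq_zero_AE)
  then show False
    unfolding integral_eexp_spectral_law using m_pos integral_eexp_U_pos[of j] by simp
qed

text \<open>The defining properties depend on the law alone and are pulled back along
  \<open>S\<close>.\<close>

lemma spectral_random_vectorI: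
  assumes N: "prob_space N" and S [measurable]: "S \<in> borel_measurable N"
    and law: "distr N borel S = spectral_law"
  shows "spectral_random_vector N S"
proof -
  interpret N: prob_space N by fact
  have AE: "AE x in N. (\<forall>j. S x $ j \<le> 0) \<and> vmax (S x) = 0"
    using AE_spectral_law_support unfolding law[symmetric]
    by (subst (asm) AE_distr_iff) (auto, measurable)
  have "measure N {x \<in> space N. vmax (S x) = 0} = 1"
    using AE by (subst N.prob_Collect_eq_1) (auto elim: eventually_mono, measurable)
  moreover have "measure N {x \<in> space N. S x $ j > -\<infinity>} > 0" for j
  proof -
    have "measure spectral_law {s. s $ j > -\<infinity>} = measure N (S -` {s. s $ j > -\<infinity>} \<inter> space N)"
      unfolding law[symmetric] by (rule measure_distr) measurable
    also have "S -` {s. s $ j > -\<infinity>} \<inter> space N = {x \<in> space N. S x $ j > -\<infinity>}" by auto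
    finally show ?thesis using measure_spectral_law_finite_pos[of j] by simp
  qed
  ultimately show ?thesis
    unfolding spectral_random_vector_def using N S AE by (auto elim: eventually_mono)
qed

section \<open>The cdf of S + E in terms of U\<close>

lemma cdf_GP_S_spectral_law:
  "measure (GP_S spectral_law) {x. \<forall>j. x $ j \<le> ereal (z $ j)} =
    1 - (\<integral>x. min (w x) (eexp (vmax (\<chi> j. U x $ j - ereal (z $ j)))) \<partial>M) / m"
proof -
  let ?f = "\<lambda>s :: ereal ^ 'd. min 1 (eexp (vmax (\<chi> j. s $ j - ereal (z $ j))))"
  have [measurable]: "(\<lambda>s :: ereal ^ 'd. vmax (\<chi> j. s $ j - ereal (z $ j))) \<in> borel_measurable borel"
    by (intro borel_measurable_vmax) measurable
  have "AE s in spectral_law. \<forall>j. s $ j < \<infinity>"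
    using AE_spectral_law_support
  proof eventually_elim
    case (elim s)
    have "s $ j < \<infinity>" for j using le_less_trans[of "s $ j" 0 \<infinity>] elim by simp
    then show ?case by simp
  qed
  then have "measure (GP_S spectral_law) {x. \<forall>j. x $ j \<le> ereal (z $ j)} = 1 - (\<integral>s. ?f s \<partial>spectral_law)"
    by (intro cdf_GP_S prob_space_spectral_law) simp_all
  also have "(\<integral>s. ?f s \<partial>spectral_law) = (\<integral>x. ?f (shifted x) * w x \<partial>M) / m"
    by (rule integral_spectral_law) measurable
  also have "(\<integral>x. ?f (shifted x) * w x \<partial>M)
      = (\<integral>x. min (w x) (eexp (vmax (\<chi> j. U x $ j - ereal (z $ j)))) \<partial>M)"
  proof (rule Bochner_Integration.integral_cong[OF refl])
    fix x assume x: "x \<in> space M"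
    show "?f (shifted x) * w x = min (w x) (eexp (vmax (\<chi> j. U x $ j - ereal (z $ j))))"
    \<comment> \<open>For positive weight the shifted vector is at most 0 and the rules for
      \<open>eexp\<close> apply. For weight 0 both sides vanish.\<close>
    proof (cases "0 < w x")
      case True
      have fin: "shifted x $ j < \<infinity>" for j
        using shifted_le_0(1)[OF x True, of j] by (cases "shifted x $ j") auto
      have "w x * eexp (vmax (\<chi> j. shifted x $ j - ereal (z $ j)))
          = w x * vmax (\<chi> j. exp (- (z $ j)) * eexp (shifted x $ j))"
        by (simp add: eexp_vmax_diff[OF fin])
      also have "\<dots> = vmax (\<chi> j. exp (- (z $ j)) * (eexp (shifted x $ j) * w x))"
        using vmax_mult_left[of "w x" "\<chi> j. exp (- (z $ j)) * eexp (shifted x $ j)"]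
        by (simp add: mult_ac)
      also have "\<dots> = eexp (vmax (\<chi> j. U x $ j - ereal (z $ j)))"
        by (simp add: eexp_shifted[OF x] eexp_vmax_diff[OF U_less_top[OF x]])
      finally have "eexp (vmax (\<chi> j. U x $ j - ereal (z $ j)))
          = w x * eexp (vmax (\<chi> j. shifted x $ j - ereal (z $ j)))" by simp
      \<comment> \<open>As \<open>w x\<close> is positive, \<open>min 1 b * w x\<close> equals
        \<open>min (w x) (w x * b)\<close>.\<close>
      then show ?thesis
        using True by (simp add: min_def mult.commute[of _ "w x"] mult_le_cancel_left1)
    next
      case False
      then have "w x = 0" by (simp add: order.antisym not_less)
      then show ?thesis by (simp add: min_def)
    qed
  qed
  finally show ?thesis .
qed

section \<open>The parameters of the generalized Pareto law\<close>

text \<open>The generating vector \<open>V\<close> is the exponential of U with each coordinate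
  divided by its own mean, so its means are 1; \<nu> is its law.\<close>

lemma is_stdf_spectral_law:
  assumes l: "\<And>y. (\<And>j. 0 \<le> y $ j) \<Longrightarrow>
    l y = (\<integral>x. vmax (\<chi> j. y $ j * (eexp (U x $ j) / (\<integral>x'. eexp (U x' $ j) \<partial>M))) \<partial>M)"
  shows "is_stdf l"
proof -
  define V :: "'a \<Rightarrow> real ^ 'd" where
    "V x = (\<chi> j. eexp (U x $ j) / (\<integral>x'. eexp (U x' $ j) \<partial>M))" for x
  have V [measurable]: "V \<in> borel_measurable M"
    unfolding V_def[abs_def] by (intro borel_measurable_vec_lambda_real) measurable
  have E: "(\<integral>x. V x $ j \<partial>M) = 1" for j
    using integral_eexp_U_pos[of j] by (simp add: V_def)
  have nonneg: "0 \<le> V x $ j" for x j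
    using integral_eexp_U_pos[of j] by (simp add: V_def less_imp_le)
  show ?thesis
    unfolding is_stdf_def
  proof (intro exI[of _ "distr M borel V"] conjI allI impI)
    show "prob_space (distr M borel V)" by (rule prob_space_distr) simp
    show "AE v in distr M borel V. \<forall>j. 0 \<le> v $ j"
      by (subst AE_distr_iff) (auto simp: nonneg, measurable)
    show "(\<integral>v. v $ j \<partial>distr M borel V) = 1" for j
      by (subst integral_distr) (auto simp: E)
    fix y :: "real ^ 'd" assume "\<forall>j. 0 \<le> y $ j"
    moreover have "(\<lambda>v :: real ^ 'd. vmax (\<chi> j. y $ j * v $ j)) \<in> borel_measurable borel"
      by (intro borel_measurable_vmax) measurable
    ultimately show "l y = (\<integral>v. vmax (\<chi> j. y $ j * v $ j) \<partial>distr M borel V)"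
      by (subst integral_distr) (auto simp: l V_def)
  qed simp
qed

lemma is_GP_spectral_law:
  assumes p: "\<And>j. p $ j = (\<integral>x. eexp (U x $ j) \<partial>M) / m"
    and l: "\<And>y. (\<And>j. 0 \<le> y $ j) \<Longrightarrow>
      l y = (\<integral>x. vmax (\<chi> j. y $ j * (eexp (U x $ j) / (\<integral>x'. eexp (U x' $ j) \<partial>M))) \<partial>M)"
  shows "is_GP (GP_S spectral_law) p l"
proof -
  have p01: "0 < p $ j" "p $ j \<le> 1" for j
    using m_pos integral_eexp_U_pos[of j] integral_eexp_U_le_m[of j] by (auto simp: p)
  \<comment> \<open>The factor \<open>p $ j\<close> cancels the mean in the denominator and leaves
    the common factor \<open>1 / m\<close>. Taking \<open>c = 1\<close> gives
    \<open>l p = 1\<close>, and the two exponential weights give the terms of the cdf.\<close>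
  have l_mult: "l (\<chi> j. p $ j * c $ j) = (\<integral>x. vmax (\<chi> j. c $ j * eexp (U x $ j)) \<partial>M) / m"
    if c: "\<And>j. 0 \<le> c $ j" for c
  proof -
    have "l (\<chi> j. p $ j * c $ j) = (\<integral>x. vmax (\<chi> j. 1 / m * (c $ j * eexp (U x $ j))) \<partial>M)"
    proof (subst l)
      show "0 \<le> (\<chi> j. p $ j * c $ j) $ j" for j using c p01 by (simp add: less_imp_le)
      have "p $ j * c $ j * (eexp u / (\<integral>x'. eexp (U x' $ j) \<partial>M)) = 1 / m * (c $ j * eexp u)" for j u
        using integral_eexp_U_pos[of j] by (simp add: p)
      then show "(\<integral>x. vmax (\<chi> j. (\<chi> j. p $ j * c $ j) $ j * (eexp (U x $ j) / (\<integral>x'. eexp (U x' $ j) \<partial>M))) \<partial>M)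
          = (\<integral>x. vmax (\<chi> j. 1 / m * (c $ j * eexp (U x $ j))) \<partial>M)"
        by simp
    qed
    also have "\<dots> = (\<integral>x. 1 / m * vmax (\<chi> j. c $ j * eexp (U x $ j)) \<partial>M)"
    proof (rule Bochner_Integration.integral_cong[OF refl])
      show "vmax (\<chi> j. 1 / m * (c $ j * eexp (U x $ j))) = 1 / m * vmax (\<chi> j. c $ j * eexp (U x $ j))" for x
        using vmax_mult_left[of "1 / m" "\<chi> j. c $ j * eexp (U x $ j)"] m_pos by simp
    qed
    finally show ?thesis by simp
  qed
  have int_w: "(\<integral>x. vmax (\<chi> j. eexp (U x $ j)) \<partial>M) = m"
    unfolding m_def by (rule Bochner_Integration.integral_cong) (simp_all add: w_eq_vmax)
  have "l p = 1"
    using l_mult[of "\<chi> j. 1"] m_pos by (simp add: int_w)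
  moreover have "measure (GP_S spectral_law) {x. \<forall>j. x $ j \<le> ereal (z $ j)} =
      l (\<chi> j. p $ j * exp (- min (z $ j) 0)) - l (\<chi> j. p $ j * exp (- (z $ j)))" for z
  proof -
    let ?W = "\<lambda>x. vmax (\<chi> j. exp (- (z $ j)) * eexp (U x $ j))"
    have intW: "integrable M ?W"
      using integrable_vmax_eexp_U[of "\<chi> j. exp (- (z $ j))"] by simp
    have intMin: "integrable M (\<lambda>x. min (w x) (?W x))"
      using integrable_min[OF integrable_w intW] .
    have "l (\<chi> j. p $ j * exp (- min (z $ j) 0))
        = (\<integral>x. vmax (\<chi> j. exp (- min (z $ j) 0) * eexp (U x $ j)) \<partial>M) / m"
      using l_mult[of "\<chi> j. exp (- min (z $ j) 0)"] by simp
    also have "(\<integral>x. vmax (\<chi> j. exp (- min (z $ j) 0) * eexp (U x $ j)) \<partial>M)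
        = (\<integral>x. w x + ?W x - min (w x) (?W x) \<partial>M)"
    proof (rule Bochner_Integration.integral_cong[OF refl])
      fix x assume x: "x \<in> space M"
      \<comment> \<open>Because \<open>exp (- min t 0) = max 1 (exp (- t))\<close> for every real
        \<open>t\<close>.\<close>
      have "exp (- min (z $ j) 0) * e = max e (exp (- (z $ j)) * e)" if "0 \<le> e" for j e
        using that by (auto simp: min_def max_def mult_le_cancel_right2 mult_le_cancel_right1)
      then have "vmax (\<chi> j. exp (- min (z $ j) 0) * eexp (U x $ j)) = max (w x) (?W x)"
        using x vmax_max[of "\<chi> j. eexp (U x $ j)" "\<chi> j. exp (- (z $ j)) * eexp (U x $ j)"]
        by (simp add: w_eq_vmax)
      then show "vmax (\<chi> j. exp (- min (z $ j) 0) * eexp (U x $ j)) = w x + ?W x - min (w x) (?W x)"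
        by simp
    qed
    also have "\<dots> = m + (\<integral>x. ?W x \<partial>M) - (\<integral>x. min (w x) (?W x) \<partial>M)"
      using integrable_w intW intMin by (simp add: m_def)
    finally have "l (\<chi> j. p $ j * exp (- min (z $ j) 0)) - l (\<chi> j. p $ j * exp (- (z $ j)))
        = 1 - (\<integral>x. min (w x) (?W x) \<partial>M) / m"
      using l_mult[of "\<chi> j. exp (- (z $ j))"] m_pos by (simp add: field_simps)
    also have "(\<integral>x. min (w x) (?W x) \<partial>M)
        = (\<integral>x. min (w x) (eexp (vmax (\<chi> j. U x $ j - ereal (z $ j)))) \<partial>M)"
      by (rule Bochner_Integration.integral_cong) (simp_all only: eexp_vmax_diff[OF U_less_top])
    finally show ?thesis by (simp add: cdf_GP_S_spectral_law)
  qed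
  moreover have "is_stdf l" using l by (rule is_stdf_spectral_law)
  moreover have "prob_space (GP_S spectral_law)"
    by (intro prob_space_GP_S prob_space_spectral_law) simp
  moreover have "AE x in GP_S spectral_law. (\<forall>j. x $ j < \<infinity>) \<and> \<not> (\<forall>j. x $ j \<le> 0)"
    by (intro AE_GP_S prob_space_spectral_law AE_spectral_law_support) simp
  moreover have "sets (GP_S spectral_law) = sets borel" by (simp add: GP_S_def)
  ultimately show ?thesis unfolding is_GP_def using p01 by blast
qed

text \<open>Uniqueness of the parameters compares an arbitrary admissible pair with the explicit
  one; conversely, formulas valid on the orthant suffice for admissibility.\<close>

lemma is_GP_spectral_law_iff:
  "is_GP (GP_S spectral_law) p l \<longleftrightarrow>
    (\<forall>j. p $ j = (\<integral>x. eexp (U x $ j) \<partial>M) / m) \<and>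
    (\<forall>y. (\<forall>j. 0 \<le> y $ j) \<longrightarrow>
      l y = (\<integral>x. vmax (\<chi> j. y $ j * (eexp (U x $ j) / (\<integral>x'. eexp (U x' $ j) \<partial>M))) \<partial>M))"
  (is "?L \<longleftrightarrow> ?R")
proof
  assume L: ?L
  let ?p = "\<chi> j. (\<integral>x. eexp (U x $ j) \<partial>M) / m"
  let ?l = "\<lambda>y. \<integral>x. vmax (\<chi> j. y $ j * (eexp (U x $ j) / (\<integral>x'. eexp (U x' $ j) \<partial>M))) \<partial>M"
  have "is_GP (GP_S spectral_law) ?p ?l" by (rule is_GP_spectral_law) simp_all
  from is_GP_unique[OF L this] show ?R by simp
next
  assume ?R
  then show ?L by (intro is_GP_spectral_law) simp_all
qed

text \<open>Both laws are finite, so agreement of the real-valued probabilities is agreement of the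
  measures. Results on \<open>spectral_law\<close> thereby hold for every realization of S.\<close>

lemma distr_eq_spectral_law:
  assumes N: "prob_space N" and S [measurable]: "S \<in> borel_measurable N"
    and eq: "\<And>A. A \<in> sets borel \<Longrightarrow> measure N {x \<in> space N. S x \<in> A} = spectral_prob M U A"
  shows "distr N borel S = spectral_law"
proof (rule measure_eqI)
  interpret D: prob_space "distr N borel S" using N S by (rule prob_space.prob_space_distr)
  interpret Q: prob_space spectral_law by (rule prob_space_spectral_law)
  fix A assume "A \<in> sets (distr N borel S)"
  then have A: "A \<in> sets borel" by simp
  have "S -` A \<inter> space N = {x \<in> space N. S x \<in> A}" by auto
  then have "measure (distr N borel S) A = measure spectral_law A"
    using A by (simp add: measure_distr eq measure_spectral_law)
  then show "emeasure (distr N borel S) A = emeasure spectral_law A"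
    by (simp add: D.emeasure_eq_measure Q.emeasure_eq_measure)
qed simp

end

text \<open>The claims on S range over all its realizations on spaces of type \<open>'b\<close>, so
  the existence of a law with the prescribed probabilities is a separate conjunct. The equivalence
  for \<open>is_GP\<close> expresses that the parameters are determined.\<close>

theorem proposition4p7:
  fixes M :: "'a measure" and U :: "'a \<Rightarrow> ereal ^ 'd::finite"
  assumes "prob_space M"
    and "U \<in> borel_measurable M"
    and "\<And>x j. x \<in> space M \<Longrightarrow> U x $ j < \<infinity>"
    and "\<And>j. integrable M (\<lambda>x. eexp (U x $ j))"
    and "\<And>j. 0 < (\<integral>x. eexp (U x $ j) \<partial>M)"
  shows "(\<exists>Q :: (ereal ^ 'd) measure. prob_space Q \<and> sets Q = sets borel \<and>
            (\<forall>A \<in> sets borel. measure Q A = spectral_prob M U A))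
    \<and> (\<forall>(N :: 'b measure) (S :: 'b \<Rightarrow> ereal ^ 'd).
          prob_space N \<and> S \<in> borel_measurable N \<and>
          (\<forall>A \<in> sets borel. measure N {x \<in> space N. S x \<in> A} = spectral_prob M U A)
        \<longrightarrow>
          spectral_random_vector N S
          \<and> (\<forall>p l. is_GP (GP_S (distr N borel S)) p l \<longleftrightarrow>
                (\<forall>j. p $ j = (\<integral>x. eexp (U x $ j) \<partial>M) / (\<integral>x. eexp (vmax (U x)) \<partial>M)) \<and>
                (\<forall>y. (\<forall>j. 0 \<le> y $ j) \<longrightarrow>
                   l y = (\<integral>x. vmax (\<chi> j. y $ j * (eexp (U x $ j) / (\<integral>x'. eexp (U x' $ j) \<partial>M))) \<partial>M)))
          \<and> (\<forall>z :: real ^ 'd.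
                measure (GP_S (distr N borel S)) {x. \<forall>j. x $ j \<le> ereal (z $ j)} =
                1 - (\<integral>x. min (eexp (vmax (U x))) (eexp (vmax (\<chi> j. U x $ j - ereal (z $ j)))) \<partial>M) / (\<integral>x. eexp (vmax (U x)) \<partial>M)))"
proof -
  interpret exponentially_integrable M U
    using assms by (auto simp: exponentially_integrable_def exponentially_integrable_axioms_def)
  show ?thesis
  proof (intro conjI allI impI)
    show "\<exists>Q :: (ereal ^ 'd) measure. prob_space Q \<and> sets Q = sets borel \<and>
        (\<forall>A \<in> sets borel. measure Q A = spectral_prob M U A)"
      using prob_space_spectral_law measure_spectral_law by (intro exI[of _ spectral_law]) simp
  next
    fix N :: "'b measure" and S :: "'b \<Rightarrow> ereal ^ 'd"
    assume "prob_space N \<and> S \<in> borel_measurable N \<and>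
      (\<forall>A \<in> sets borel. measure N {x \<in> space N. S x \<in> A} = spectral_prob M U A)"
    then have N: "prob_space N" and S: "S \<in> borel_measurable N"
      and law: "distr N borel S = spectral_law" by (simp_all add: distr_eq_spectral_law)
    show "spectral_random_vector N S" using N S law by (rule spectral_random_vectorI)
    note unfold = law w_def[symmetric] m_def[symmetric]
    show "is_GP (GP_S (distr N borel S)) p l \<longleftrightarrow>
        (\<forall>j. p $ j = (\<integral>x. eexp (U x $ j) \<partial>M) / (\<integral>x. eexp (vmax (U x)) \<partial>M)) \<and>
        (\<forall>y. (\<forall>j. 0 \<le> y $ j) \<longrightarrow>
          l y = (\<integral>x. vmax (\<chi> j. y $ j * (eexp (U x $ j) / (\<integral>x'. eexp (U x' $ j) \<partial>M))) \<partial>M))" for p l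
      unfolding unfold by (rule is_GP_spectral_law_iff)
    show "measure (GP_S (distr N borel S)) {x. \<forall>j. x $ j \<le> ereal (z $ j)} =
        1 - (\<integral>x. min (eexp (vmax (U x))) (eexp (vmax (\<chi> j. U x $ j - ereal (z $ j)))) \<partial>M)
          / (\<integral>x. eexp (vmax (U x)) \<partial>M)" for z
      unfolding unfold by (rule cdf_GP_S_spectral_law)
  qed
qed

end
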